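(* Let $V$ satisfy condition (P) and let $\xi$ satisfy condition (C) of the context. Then there exists a unique $C^1$ zero-flux stationary density for $\xi$, and it is given by $$\pi_\xi(x)=g_\xi^{-1}(\mu_\xi-V(x)),\qquad x\in\mathbb R^d,$$ where $\mu_\xi\in\mathbb R$ is the unique constant satisfying $$\int_{v_\star}^{\infty} g_\xi^{-1}(\mu_\xi-s)\,m_V(s)\,\mathrm ds=1 .$$ Equivalently, $\pi_\xi(x)=q_\xi(V(x))$, where $q_\xi(s):=g_\xi^{-1}(\mu_\xi-s)$ solves $$q_\xi'(s)=-q_\xi(s)\,\xi(q_\xi(s)),\qquad s>v_\star,$$ with the initial value $a_\xi:=q_\xi(v_\star)$ chosen so that $\int_{v_\star}^\infty q_\xi(s)m_V(s)\,\mathrm ds=1$.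
   Context: Condition (P) on the potential: $d\ge 1$; $V:\mathbb R^d\to[v_\star,\infty)$ is $C^2$ and coercive ($V(x)\to\infty$ as $\|x\|\to\infty$), $v_\star=\min_{\mathbb R^d}V$, and $e^{-aV}$ is Lebesgue integrable for every $a>0$. The level-set function $m_V(s)=\int_{\{V=s\}}\|\nabla V(x)\|_2^{-1}\,\mathcal H^{d-1}(\mathrm dx)$, $s>v_\star$, is locally finite and is bounded above and below by positive constants on compact intervals away from critical values of $V$. It serves as the density of the image of Lebesgue measure under $V$: $\int_{\mathbb R^d}\varphi(V(x))\,\mathrm dx=\int_{v_\star}^\infty\varphi(s)m_V(s)\,\mathrm ds$ for measurable $\varphi\ge0$. Condition (C) on the coefficient: there are constants $0<\kappa<K<\infty$ and $L<\infty$ such that $\xi:[0,\infty)\to\mathbb R$ satisfies $\kappa\le\xi(r)\le K$ and $|\xi(r)-\xi(u)|\le L|r-u|$ for all $r,u\ge0$. Notation: $g_\xi(r)=\int_1^r (u\xi(u))^{-1}\,\mathrm du$ for $r>0$ (a bijection $(0,\infty)\to\mathbb R$). A $C^1$ zero-flux stationary density for $\xi$ is a nonnegative $C^1$ function $\pi:\mathbb R^d\to\mathbb R$ with $\int_{\mathbb R^d}\pi=1$ and $\nabla\pi(x)+\pi(x)\,\xi(\pi(x))\,\nabla V(x)=0$ for all $x$ (the zero-flux stationary equation of the nonlinear Fokker–Planck equation $\partial_tp_t-\Delta p_t-\nabla\cdot(\nabla V\,\xi(p_t)p_t)=0$). *)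

theory Defs
  imports "HOL-Analysis.Analysis"
begin

section \<open>Hausdorff measure\<close>

text \<open>
  The constant \<open>unit_ball_vol m / 2 ^ m\<close> is the usual normalisation, for which the
  \<open>m\<close>-dimensional Hausdorff measure is surface measure on \<open>m\<close>-dimensional submanifolds
  (counting measure for \<open>m = 0\<close>, where \<open>0 ^ 0 = 1\<close> is used for singletons).
  Boundedness of the covering sets is required explicitly because \<^const>\<open>diameter\<close>
  is meaningless on unbounded sets; the empty set has to be excluded for \<open>m = 0\<close>.
\<close>

definition hausdorff_content :: "nat \<Rightarrow> real \<Rightarrow> 'a::metric_space set \<Rightarrow> ennreal" where
  "hausdorff_content m \<delta> A =
     (INF C \<in> {C :: nat \<Rightarrow> 'a set. A \<subseteq> (\<Union>i. C i) \<and> (\<forall>i. bounded (C i) \<and> diameter (C i) \<le> \<delta>)}.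
        \<Sum>i. if C i = {} then 0
             else ennreal (unit_ball_vol (real m) * (diameter (C i) / 2) ^ m))"

definition hausdorff_outer :: "nat \<Rightarrow> 'a::metric_space set \<Rightarrow> ennreal" where
  "hausdorff_outer m A = (SUP \<delta>\<in>{0<..}. hausdorff_content m \<delta> A)"

text \<open>A metric outer measure is countably additive on Borel sets, so the following does
  not fall into the degenerate case of \<^const>\<open>measure_of\<close>.\<close>

definition hausdorff_measure :: "nat \<Rightarrow> 'a::metric_space measure" where
  "hausdorff_measure m = measure_of UNIV (sets borel) (hausdorff_outer m)"

section \<open>Smoothness\<close>

definition C1 :: "('a::real_normed_vector \<Rightarrow> 'b::real_normed_vector) \<Rightarrow> bool" where
  "C1 f \<longleftrightarrow> (\<exists>f' :: 'a \<Rightarrow> 'a \<Rightarrow>\<^sub>L 'b.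
     (\<forall>x. (f has_derivative blinfun_apply (f' x)) (at x)) \<and> continuous_on UNIV f')"

definition C2 :: "('a::real_normed_vector \<Rightarrow> 'b::real_normed_vector) \<Rightarrow> bool" where
  "C2 f \<longleftrightarrow> (\<exists>f' :: 'a \<Rightarrow> 'a \<Rightarrow>\<^sub>L 'b.
     (\<forall>x. (f has_derivative blinfun_apply (f' x)) (at x)) \<and> C1 f')"

definition gradient :: "('a::euclidean_space \<Rightarrow> real) \<Rightarrow> 'a \<Rightarrow> 'a" where
  "gradient f x = (THE D. GDERIV f x :> D)"

section \<open>The potential\<close>

definition v_star :: "('a::euclidean_space \<Rightarrow> real) \<Rightarrow> real" where
  "v_star V = (LEAST s. s \<in> range V)"

text \<open>Values are extended, and \<open>inverse 0 = \<infinity>\<close> there: \<open>m_V V s\<close> may be infinite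
  when \<open>s\<close> is a critical value.\<close>

definition m_V :: "('a::euclidean_space \<Rightarrow> real) \<Rightarrow> real \<Rightarrow> ennreal" where
  "m_V V s = (\<integral>\<^sup>+ x\<in>{x. V x = s}. inverse (ennreal (norm (gradient V x)))
                \<partial>hausdorff_measure (DIM('a) - 1))"

definition critical_values :: "('a::euclidean_space \<Rightarrow> real) \<Rightarrow> real set" where
  "critical_values V = V ` {x. gradient V x = 0}"

text \<open>
  ``Locally finite'' is read as local integrability of \<open>m_V\<close> on \<open>(v\<^sub>\<star>, \<infinity>)\<close>: pointwise
  finiteness would exclude, for example, Morse saddles in dimension two.
  The last conjunct is a genuine restriction; it fails, for instance, if \<open>V\<close> attains its
  minimum on a set of positive measure.
\<close>

definition condition_P :: "('a::euclidean_space \<Rightarrow> real) \<Rightarrow> bool" where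
  "condition_P V \<longleftrightarrow>
     C2 V \<and>
     filterlim V at_top at_infinity \<and>
     (\<forall>a>0. integrable lborel (\<lambda>x. exp (- a * V x))) \<and>
     m_V V \<in> borel_measurable (restrict_space lebesgue {v_star V<..}) \<and>
     (\<forall>a b. v_star V < a \<longrightarrow> (\<integral>\<^sup>+ s\<in>{a..b}. m_V V s \<partial>lebesgue) < \<infinity>) \<and>
     (\<forall>a b. v_star V < a \<and> {a..b} \<inter> critical_values V = {} \<longrightarrow>
        (\<exists>c C. 0 < c \<and> (\<forall>s\<in>{a..b}. ennreal c \<le> m_V V s \<and> m_V V s \<le> ennreal C))) \<and>
     (\<forall>\<phi> :: real \<Rightarrow> ennreal. \<phi> \<in> borel_measurable borel \<longrightarrow>
        (\<integral>\<^sup>+ x. \<phi> (V x) \<partial>lborel) = (\<integral>\<^sup>+ s\<in>{v_star V<..}. \<phi> s * m_V V s \<partial>lebesgue))"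

section \<open>The coefficient\<close>

text \<open>Coefficients are functions on \<open>[0, \<infinity>)\<close>; their values at negative arguments are
  irrelevant.\<close>

definition condition_C :: "(real \<Rightarrow> real) \<Rightarrow> bool" where
  "condition_C \<xi> \<longleftrightarrow>
     (\<exists>\<kappa> K L. 0 < \<kappa> \<and> \<kappa> < K \<and>
        (\<forall>r\<ge>0. \<kappa> \<le> \<xi> r \<and> \<xi> r \<le> K) \<and>
        (\<forall>r\<ge>0. \<forall>u\<ge>0. \<bar>\<xi> r - \<xi> u\<bar> \<le> L * \<bar>r - u\<bar>))"

definition g :: "(real \<Rightarrow> real) \<Rightarrow> real \<Rightarrow> real" where
  "g \<xi> r = (LBINT u=ereal 1..ereal r. 1 / (u * \<xi> u))"

definition g_inv :: "(real \<Rightarrow> real) \<Rightarrow> real \<Rightarrow> real" where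
  "g_inv \<xi> = the_inv_into {0<..} (g \<xi>)"

section \<open>Stationary densities\<close>

definition zero_flux_stationary_density ::
    "('a::euclidean_space \<Rightarrow> real) \<Rightarrow> (real \<Rightarrow> real) \<Rightarrow> ('a \<Rightarrow> real) \<Rightarrow> bool" where
  "zero_flux_stationary_density V \<xi> \<pi> \<longleftrightarrow>
     C1 \<pi> \<and> (\<forall>x. 0 \<le> \<pi> x) \<and> has_bochner_integral lborel \<pi> 1 \<and>
     (\<forall>x. gradient \<pi> x + (\<pi> x * \<xi> (\<pi> x)) *\<^sub>R gradient V x = 0)"

text \<open>\<open>mass V q\<close> is the integral of \<open>q(s) m_V(s)\<close> over \<open>(v\<^sub>\<star>, \<infinity>)\<close>, used for \<open>q \<ge> 0\<close> only.\<close>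

definition mass :: "('a::euclidean_space \<Rightarrow> real) \<Rightarrow> (real \<Rightarrow> real) \<Rightarrow> ennreal" where
  "mass V q = (\<integral>\<^sup>+ s\<in>{v_star V<..}. ennreal (q s) * m_V V s \<partial>lebesgue)"

definition mu :: "('a::euclidean_space \<Rightarrow> real) \<Rightarrow> (real \<Rightarrow> real) \<Rightarrow> real" where
  "mu V \<xi> = (THE \<mu>. mass V (\<lambda>s. g_inv \<xi> (\<mu> - s)) = 1)"

definition q_fun :: "('a::euclidean_space \<Rightarrow> real) \<Rightarrow> (real \<Rightarrow> real) \<Rightarrow> real \<Rightarrow> real" where
  "q_fun V \<xi> s = g_inv \<xi> (mu V \<xi> - s)"

definition ivp_solution ::
    "(real \<Rightarrow> real) \<Rightarrow> real \<Rightarrow> real \<Rightarrow> (real \<Rightarrow> real) \<Rightarrow> bool" where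
  "ivp_solution \<xi> v a p \<longleftrightarrow>
     p v = a \<and> continuous_on {v..} p \<and> (\<forall>s\<ge>v. 0 \<le> p s) \<and>
     (\<forall>s>v. (p has_real_derivative - p s * \<xi> (p s)) (at s))"

end

theory Submission
  imports Defs
begin

text \<open>
  Write \<open>h\<close> for \<open>g_inv \<xi>\<close>; it satisfies \<open>h' = h \<xi>(h)\<close>. Wherever a nonnegative \<open>f\<close> solving
  \<open>f' = - f \<xi>(f) W'\<close> is positive, \<open>g \<xi> \<circ> f + W\<close> is locally constant, so for each \<open>c\<close> the set
  \<open>{f = h (c - W)}\<close> is open; being also closed, it is empty or everything on a connected domain.
  Both the stationary equation (\<open>W = V\<close>) and the initial value problem (\<open>W s = s\<close>) therefore have
  only the solutions \<open>0\<close> and \<open>h (c - W)\<close>. Since the logarithmic derivative of \<open>h\<close> lies in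
  \<open>[\<kappa>, K]\<close>, so do the difference quotients of \<open>c \<mapsto> ln (\<integral> h (c - V))\<close>, which hence vanishes
  for exactly one \<open>c\<close>.
\<close>

section \<open>Gradients\<close>

text \<open>Riesz representation in coordinates: the representing vector collects the values of the
  functional on the basis. It supplies the existence that the \<open>THE\<close> in
  \<open>gradient\<close> needs.\<close>

lemma has_derivative_imp_gderiv:
  fixes f :: "'a::euclidean_space \<Rightarrow> real"
  assumes "(f has_derivative f') (at x)"
  shows "GDERIV f x :> (\<Sum>b\<in>Basis. f' b *\<^sub>R b)"
proof -
  have lin: "linear f'" using assms by (rule has_derivative_linear)
  have "f' = (\<lambda>h. h \<bullet> (\<Sum>b\<in>Basis. f' b *\<^sub>R b))"
  proof
    fix h
    have "f' h = f' (\<Sum>b\<in>Basis. (h \<bullet> b) *\<^sub>R b)" by (simp add: euclidean_representation)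
    also have "\<dots> = (\<Sum>b\<in>Basis. (h \<bullet> b) * f' b)"
      by (simp add: linear_sum[OF lin] linear_scale[OF lin])
    also have "\<dots> = h \<bullet> (\<Sum>b\<in>Basis. f' b *\<^sub>R b)"
      by (simp add: inner_sum_right mult.commute)
    finally show "f' h = h \<bullet> (\<Sum>b\<in>Basis. f' b *\<^sub>R b)" .
  qed
  then show ?thesis using assms by (simp add: gderiv_def)
qed

lemma gradient_eq:
  fixes f :: "'a::euclidean_space \<Rightarrow> real"
  assumes "GDERIV f x :> D"
  shows "gradient f x = D"
  unfolding gradient_def
proof (rule the_equality)
  fix D' assume "GDERIV f x :> D'"
  then have "(\<lambda>h. h \<bullet> D') = (\<lambda>h. h \<bullet> D)"
    using assms has_derivative_unique unfolding gderiv_def by blast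
  then have "\<forall>h. h \<bullet> D' = h \<bullet> D" by metis
  then show "D' = D" by (simp only: vector_eq_ldot)
qed (fact assms)

lemma has_derivative_gradient:
  fixes f :: "'a::euclidean_space \<Rightarrow> real"
  assumes "f differentiable (at x)"
  shows "(f has_derivative (\<lambda>h. h \<bullet> gradient f x)) (at x)"
  using assms has_derivative_imp_gderiv gradient_eq unfolding differentiable_def gderiv_def
  by metis

lemma C1_imp_differentiable: "C1 f \<Longrightarrow> f differentiable (at x)"
  unfolding C1_def differentiable_def by blast

lemma C1_imp_continuous_on: "C1 f \<Longrightarrow> continuous_on S f"
  using C1_imp_differentiable differentiable_imp_continuous_within
  by (blast intro: continuous_at_imp_continuous_on)

lemma C2_imp_C1: "C2 f \<Longrightarrow> C1 f"
  unfolding C2_def C1_def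
  by (metis C1_def C1_imp_continuous_on)

section \<open>Minima, roots and mass\<close>

text \<open>Used to see that the \<open>LEAST\<close> in \<open>v_star\<close> is an attained value,
  hence a lower bound of \<open>V\<close>.\<close>

lemma coercive_attains_min:
  fixes V :: "'a::euclidean_space \<Rightarrow> real"
  assumes cont: "continuous_on UNIV V" and lim: "filterlim V at_top at_infinity"
  shows "\<exists>x. \<forall>y. V x \<le> V y"
proof -
  have "eventually (\<lambda>x. V 0 \<le> V x) at_infinity"
    using lim by (simp add: filterlim_at_top)
  then obtain b where b: "\<And>x. b \<le> norm x \<Longrightarrow> V 0 \<le> V x"
    unfolding eventually_at_infinity by blast
  \<comment> \<open>With \<open>max b 0\<close> the origin lies in the ball even for negative
    \<open>b\<close>, so the minimum over the ball is at most \<open>V 0\<close> and is thus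
    global.\<close>
  have "\<exists>x\<in>cball 0 (max b 0). \<forall>y\<in>cball 0 (max b 0). V x \<le> V y"
    using cont by (intro continuous_attains_inf) (auto intro: continuous_on_subset)
  then obtain x where x: "\<And>y. norm y \<le> max b 0 \<Longrightarrow> V x \<le> V y" by (metis mem_cball_0)
  have "V x \<le> V y" for y
  proof (cases "norm y \<le> max b 0")
    case False
    then show ?thesis using b[of y] x[of 0] by (simp add: not_le)
  qed (fact x)
  then show ?thesis by blast
qed

text \<open>The lower bound gives injectivity and a sign change, the upper one continuity. It will
  be applied to the logarithm of the mass.\<close>

lemma bilipschitz_unique_root:
  fixes F :: "real \<Rightarrow> real"
  assumes "0 < \<kappa>" and bnd: "\<And>a b. a \<le> b \<Longrightarrow> \<kappa> * (b - a) \<le> F b - F a \<and> F b - F a \<le> K * (b - a)"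
  shows "\<exists>!c. F c = 0"
proof -
  \<comment> \<open>Over a length \<open>T\<close> the function moves by at least
    \<open>\<kappa> * T\<close>, just enough to offset the value at 0.\<close>
  define T where "T = \<bar>F 0\<bar> / \<kappa>"
  have T: "0 \<le> T" "\<kappa> * T = \<bar>F 0\<bar>" using assms(1) by (auto simp: T_def)
  have "F (-T) \<le> 0" "0 \<le> F T" using bnd[of "-T" 0] bnd[of 0 T] T by auto
  moreover have "continuous_on UNIV F"
  proof (rule lipschitz_on_continuous_on)
    have K: "0 \<le> K" using bnd[of 0 1] assms(1) by simp
    have *: "\<bar>F b - F a\<bar> \<le> K * \<bar>b - a\<bar>" if "a \<le> b" for a b
    proof -
      have "0 \<le> \<kappa> * (b - a)" using that assms(1) by simp
      then have "0 \<le> F b - F a" using bnd[OF that] by linarith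
      then show ?thesis using bnd[OF that] that by simp
    qed
    show "K-lipschitz_on UNIV F"
    proof (rule lipschitz_onI)
      fix a b
      show "dist (F a) (F b) \<le> K * dist a b"
        using *[of a b] *[of b a] by (cases "a \<le> b") (auto simp: dist_real_def abs_minus_commute)
    qed (fact K)
  qed
  ultimately obtain c where "F c = 0"
    using IVT'[of F "-T" 0 T] T(1) continuous_on_subset
    by (metis UNIV_I neg_le_0_iff_le order_trans subsetI)
  moreover have "a = b" if "F a = 0" "F b = 0" for a b
  proof -
    have *: "b = a" if "F a = 0" "F b = 0" "a \<le> b" for a b
    proof -
      have "\<kappa> * (b - a) \<le> 0" using bnd[of a b] that by simp
      then show ?thesis using assms(1) that(3) by (simp add: mult_le_0_iff)
    qed
    show ?thesis using *[of a b] *[of b a] that by force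
  qed
  ultimately show ?thesis by blast
qed

lemma v_star_le:
  assumes "condition_P V"
  shows "v_star V \<le> V x"
proof -
  have "continuous_on UNIV V" "filterlim V at_top at_infinity"
    using assms C2_imp_C1 C1_imp_continuous_on unfolding condition_P_def by blast+
  then obtain y where "\<And>z. V y \<le> V z" using coercive_attains_min by blast
  moreover from this have "v_star V = V y"
    unfolding v_star_def by (intro Least_equality) auto
  ultimately show ?thesis by simp
qed

lemma mass_cong:
  assumes "\<And>s. v_star V < s \<Longrightarrow> p s = q s"
  shows "mass V p = mass V q"
  unfolding mass_def using assms by (intro nn_integral_cong) (auto simp: indicator_def)

section \<open>The inverse of \<open>g\<close>\<close>

text \<open>Continuity of \<open>\<xi>\<close> makes \<open>g \<xi>\<close> differentiable and the
  derivative of \<open>h (c - V x)\<close> continuous in \<open>x\<close>; uniqueness for the flux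
  equation will come from separation of variables.\<close>

locale coefficient =
  fixes \<xi> :: "real \<Rightarrow> real" and \<kappa> K :: real
  assumes kappa_pos: "0 < \<kappa>"
    and xi_bounds: "\<And>r. 0 \<le> r \<Longrightarrow> \<kappa> \<le> \<xi> r \<and> \<xi> r \<le> K"
    and xi_continuous: "continuous_on {0..} \<xi>"
begin

abbreviation "h \<equiv> g_inv \<xi>"

lemma xi_pos: "0 \<le> r \<Longrightarrow> 0 < \<xi> r"
  using xi_bounds[of r] kappa_pos by linarith

lemma K_pos: "0 < K"
  using xi_bounds[of 0] kappa_pos by linarith

section \<open>The antiderivative \<open>g\<close>: derivative, monotonicity and range\<close>

lemma DERIV_g:
  assumes "0 < r"
  shows "(g \<xi> has_real_derivative 1 / (r * \<xi> r)) (at r)"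
proof -
  \<comment> \<open>A compact interval that avoids the singularity at 0, contains the base point 1
    and has \<open>r\<close> in its interior.\<close>
  define a b where "a = min 1 r / 2" and "b = max 1 r + 1"
  have ab: "0 < a" "a \<le> 1" "1 \<le> b" "a < r" "r < b"
    using assms by (auto simp: a_def b_def)
  have "continuous_on {a..b} (\<lambda>u. 1 / (u * \<xi> u))"
  proof (intro continuous_intros)
    show "continuous_on {a..b} \<xi>"
      by (rule continuous_on_subset[OF xi_continuous]) (use ab in auto)
    show "\<forall>x\<in>{a..b}. x * \<xi> x \<noteq> 0"
      using ab xi_pos by (metis atLeastAtMost_iff less_le_not_le mult_eq_0_iff order.strict_trans2)
  qed
  then have "((\<lambda>u. LBINT y=ereal 1..ereal u. 1 / (y * \<xi> y)) has_vector_derivative 1 / (r * \<xi> r))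
      (at r within {a..b})"
    using ab by (intro interval_integral_FTC2) auto
  then have "(g \<xi> has_real_derivative 1 / (r * \<xi> r)) (at r within {a..b})"
    by (simp add: has_real_derivative_iff_has_vector_derivative g_def[abs_def])
  moreover have "at r within {a..b} = at r"
    using ab by (intro at_within_interior) (simp add: interior_atLeastAtMost_real)
  ultimately show ?thesis by simp
qed

lemma g_1: "g \<xi> 1 = 0"
  by (simp add: g_def interval_integral_endpoints_same)

lemma g_strict_mono:
  assumes "0 < r" "r < s"
  shows "g \<xi> r < g \<xi> s"
proof (rule DERIV_pos_imp_increasing[OF assms(2)])
  fix x assume "r \<le> x"
  with assms(1) show "\<exists>y. (g \<xi> has_real_derivative y) (at x) \<and> 0 < y"
    using DERIV_g[of x] xi_pos[of x] by (intro exI[of _ "1 / (x * \<xi> x)"]) simp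
qed

lemma g_inj: "inj_on (g \<xi>) {0<..}"
  using g_strict_mono by (intro linorder_inj_onI') force

text \<open>The integrand of \<open>g\<close> is at least \<open>1 / (K * u)\<close>. Comparison
  with the logarithm forces \<open>g\<close> to diverge at both ends of the half-line.\<close>

lemma g_minus_ln_mono:
  assumes "0 < r" "r \<le> s"
  shows "g \<xi> r - ln r / K \<le> g \<xi> s - ln s / K"
proof (rule DERIV_nonneg_imp_nondecreasing[OF assms(2)])
  fix x assume "r \<le> x" "x \<le> s"
  then have x: "0 < x" using assms by linarith
  have "((\<lambda>r. g \<xi> r - ln r / K) has_real_derivative 1 / (x * \<xi> x) - 1 / x / K) (at x)"
    using x K_pos by (auto intro!: derivative_eq_intros DERIV_g simp: field_simps)
  moreover have "1 / x / K \<le> 1 / (x * \<xi> x)"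
    using x xi_bounds[of x] xi_pos[of x] K_pos
    by (simp add: divide_simps mult_left_mono)
  ultimately show "\<exists>y. ((\<lambda>r. g \<xi> r - ln r / K) has_real_derivative y) (at x) \<and> 0 \<le> y"
    by (metis diff_ge_0_iff_ge)
qed

lemma g_surj: "\<exists>r>0. g \<xi> r = t"
proof -
  \<comment> \<open>Chosen so that \<open>ln R / K\<close> equals the modulus of \<open>t\<close>;
    comparison with the value 0 at 1 then brackets \<open>t\<close> between
    \<open>g \<xi> (1 / R)\<close> and \<open>g \<xi> R\<close>.\<close>
  define R where "R = exp (K * \<bar>t\<bar>)"
  have R: "1 \<le> R" "ln R = K * \<bar>t\<bar>" "0 < R" using K_pos by (auto simp: R_def)
  have "\<bar>t\<bar> \<le> g \<xi> R"
    using g_minus_ln_mono[of 1 R] R K_pos g_1 by simp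
  moreover have "g \<xi> (1 / R) \<le> - \<bar>t\<bar>"
    using g_minus_ln_mono[of "1 / R" 1] R K_pos g_1 by (simp add: ln_div)
  moreover have "1 / R \<le> R" using R by (meson divide_le_eq_1_pos order_trans)
  moreover have "continuous_on {1 / R..R} (g \<xi>)"
  proof (intro continuous_at_imp_continuous_on ballI)
    fix x assume "x \<in> {1 / R..R}"
    then have "0 < x" using R by (auto intro: less_le_trans[of 0 "1 / R"])
    then show "isCont (g \<xi>) x" using DERIV_g DERIV_isCont by blast
  qed
  ultimately obtain r where "1 / R \<le> r" "g \<xi> r = t"
    using IVT'[of "g \<xi>" "1 / R" t R] by force
  moreover have "0 < 1 / R" using R by simp
  ultimately show ?thesis by (intro exI[of _ r]) linarith
qed

section \<open>Regularity and growth of the inverse \<open>h\<close>\<close>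

lemma h_g: "0 < r \<Longrightarrow> h (g \<xi> r) = r"
  unfolding g_inv_def using g_inj by (intro the_inv_into_f_f) auto

lemma h_pos: "0 < h t" and g_h: "g \<xi> (h t) = t"
  using g_surj[of t] h_g by auto

lemma h_inj: "h s = h t \<Longrightarrow> s = t"
  by (metis g_h)

lemma isCont_h: "isCont h t"
proof -
  have "isCont h (g \<xi> (h t))"
  proof (rule isCont_inverse_function[where f = "g \<xi>" and x = "h t" and d = "h t / 2"])
    show "0 < h t / 2" using h_pos by simp
    fix z assume "\<bar>z - h t\<bar> \<le> h t / 2"
    then have "0 < z" using h_pos[of t] by linarith
    then show "h (g \<xi> z) = z" "isCont (g \<xi>) z"
      using h_g DERIV_g DERIV_isCont by blast+
  qed
  then show ?thesis by (simp add: g_h)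
qed

lemma DERIV_h: "(h has_real_derivative h t * \<xi> (h t)) (at t)"
proof -
  have "(h has_real_derivative inverse (1 / (h t * \<xi> (h t)))) (at t)"
  proof (rule DERIV_inverse_function[where f = "g \<xi>" and a = "t - 1" and b = "t + 1"])
    show "(g \<xi> has_real_derivative 1 / (h t * \<xi> (h t))) (at (h t))"
      using DERIV_g h_pos by blast
    show "1 / (h t * \<xi> (h t)) \<noteq> 0"
      using h_pos[of t] xi_pos[of "h t"] by simp
  qed (auto simp: g_h isCont_h)
  then show ?thesis by simp
qed

lemma continuous_on_h [continuous_intros]:
  "continuous_on S f \<Longrightarrow> continuous_on S (\<lambda>x. h (f x))"
  by (rule continuous_on_compose2[where t = UNIV])
    (auto intro: continuous_at_imp_continuous_on isCont_h)

lemma continuous_on_xi_h: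
  assumes "continuous_on S f"
  shows "continuous_on S (\<lambda>x. \<xi> (h (f x)))"
  by (rule continuous_on_compose2[OF xi_continuous continuous_on_h[OF assms]])
    (use h_pos in \<open>auto intro: less_imp_le\<close>)

text \<open>The function \<open>ln (h t)\<close> has derivative \<open>\<xi> (h t)\<close>, so
  subtracting it from a line of slope \<open>K\<close>, or a line of slope \<open>\<kappa>\<close>
  from it, leaves a nondecreasing function.\<close>

lemma h_growth:
  assumes "s \<le> t"
  shows "exp (\<kappa> * (t - s)) * h s \<le> h t" and "h t \<le> exp (K * (t - s)) * h s"
proof -
  have D: "((\<lambda>t. ln (h t)) has_real_derivative \<xi> (h x)) (at x)" for x
    using DERIV_chain2[OF DERIV_ln[OF h_pos] DERIV_h, of x] h_pos[of x] by (simp add: field_simps)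
  have "ln (h s) - \<kappa> * s \<le> ln (h t) - \<kappa> * t"
  proof (rule DERIV_nonneg_imp_nondecreasing[OF assms])
    fix x
    have "((\<lambda>t. ln (h t) - \<kappa> * t) has_real_derivative \<xi> (h x) - \<kappa>) (at x)"
      by (intro DERIV_diff D DERIV_cmult_Id)
    then show "\<exists>y. ((\<lambda>t. ln (h t) - \<kappa> * t) has_real_derivative y) (at x) \<and> 0 \<le> y"
      using xi_bounds[of "h x"] h_pos[of x] by (intro exI[of _ "\<xi> (h x) - \<kappa>"]) auto
  qed
  then have "\<kappa> * (t - s) + ln (h s) \<le> ln (h t)" by (simp add: algebra_simps)
  then have "exp (\<kappa> * (t - s) + ln (h s)) \<le> exp (ln (h t))" by simp
  then show "exp (\<kappa> * (t - s)) * h s \<le> h t" by (simp add: exp_add h_pos)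
  have "K * s - ln (h s) \<le> K * t - ln (h t)"
  proof (rule DERIV_nonneg_imp_nondecreasing[OF assms])
    fix x
    have "((\<lambda>t. K * t - ln (h t)) has_real_derivative K - \<xi> (h x)) (at x)"
      by (intro DERIV_diff D DERIV_cmult_Id)
    then show "\<exists>y. ((\<lambda>t. K * t - ln (h t)) has_real_derivative y) (at x) \<and> 0 \<le> y"
      using xi_bounds[of "h x"] h_pos[of x] by (intro exI[of _ "K - \<xi> (h x)"]) auto
  qed
  then have "ln (h t) \<le> K * (t - s) + ln (h s)" by (simp add: algebra_simps)
  then have "exp (ln (h t)) \<le> exp (K * (t - s) + ln (h s))" by simp
  then show "h t \<le> exp (K * (t - s)) * h s" by (simp add: exp_add h_pos)
qed

section \<open>Solutions of the flux equation\<close>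

text \<open>Stated on an open connected subset of a normed space so that it covers both the gradient
  equation on the whole space and the scalar equation on an open half-line.\<close>

lemma zero_flux_cases:
  fixes f W :: "'b::real_normed_vector \<Rightarrow> real"
  assumes S: "open S" "connected S"
    and f: "\<And>x. x \<in> S \<Longrightarrow> (f has_derivative (\<lambda>y. - (f x * \<xi> (f x)) * W' x y)) (at x)"
    and W: "\<And>x. x \<in> S \<Longrightarrow> (W has_derivative W' x) (at x)"
    and nonneg: "\<And>x. x \<in> S \<Longrightarrow> 0 \<le> f x"
  obtains "\<And>x. x \<in> S \<Longrightarrow> f x = 0" | c where "\<And>x. x \<in> S \<Longrightarrow> f x = h (c - W x)"
proof (cases "\<forall>x\<in>S. f x = 0")
  case False
  then obtain x0 where x0: "x0 \<in> S" "0 < f x0" using nonneg by force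
  \<comment> \<open>The value at \<open>x0\<close> of the quantity
    \<open>g \<xi> (f x) + W x\<close>, which is to be conserved; this puts \<open>x0\<close> into
    \<open>U\<close>.\<close>
  define c where "c = g \<xi> (f x0) + W x0"
  have contf: "continuous_on S f" and contW: "continuous_on S W"
    using f W has_derivative_continuous by (blast intro: continuous_at_imp_continuous_on)+
  define U where "U = {x \<in> S. f x - h (c - W x) = 0}"
  have "closedin (top_of_set S) U"
    unfolding U_def by (intro continuous_closedin_preimage_constant continuous_intros contf contW)
  moreover have "open U"
    unfolding open_contains_ball
  proof
    fix x assume "x \<in> U"
    then have x: "x \<in> S" "f x = h (c - W x)" by (auto simp: U_def)
    \<comment> \<open>Positivity of \<open>h\<close> enters here: at a point of \<open>U\<close> the
      solution is positive, hence also on a ball, where \<open>g \<xi>\<close> may be composed with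
      it.\<close>
    have "open (S \<inter> f -` {0<..})"
      using contf S(1) open_greaterThan by (rule continuous_open_preimage)
    moreover have "x \<in> S \<inter> f -` {0<..}" using x h_pos by simp
    ultimately obtain e where e: "0 < e" "ball x e \<subseteq> S \<inter> f -` {0<..}"
      unfolding open_contains_ball by blast
    have "\<exists>k. \<forall>y\<in>ball x e. g \<xi> (f y) + W y = k"
    proof (rule has_derivative_zero_constant)
      fix y assume "y \<in> ball x e"
      then have y: "y \<in> S" "0 < f y" using e(2) by auto
      have "((\<lambda>z. g \<xi> (f z)) has_derivative
          (\<lambda>z. (- (f y * \<xi> (f y)) * W' y z) * (1 / (f y * \<xi> (f y))))) (at y)"
        using DERIV_compose_FDERIV[OF DERIV_g[OF y(2)] f[OF y(1)]] .
      moreover have "(- (f y * \<xi> (f y)) * W' y z) * (1 / (f y * \<xi> (f y))) = - W' y z" for z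
        using y(2) xi_pos[of "f y"] by simp
      ultimately have "((\<lambda>z. g \<xi> (f z)) has_derivative (\<lambda>z. - W' y z)) (at y)" by simp
      from has_derivative_add[OF this W[OF y(1)]]
      have "((\<lambda>z. g \<xi> (f z) + W z) has_derivative (\<lambda>z. 0)) (at y)" by simp
      then show "((\<lambda>z. g \<xi> (f z) + W z) has_derivative (\<lambda>z. 0)) (at y within ball x e)"
        by (rule has_derivative_at_withinI)
    qed simp
    then obtain k where k: "\<And>y. y \<in> ball x e \<Longrightarrow> g \<xi> (f y) + W y = k" by blast
    \<comment> \<open>The centre of the ball lies in \<open>U\<close>, which fixes the local
      constant.\<close>
    then have "k = c" using k[of x] e(1) x(2) by (simp add: g_h)
    have "ball x e \<subseteq> U"
    proof
      fix y assume "y \<in> ball x e"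
      then have "y \<in> S" "0 < f y" "g \<xi> (f y) = c - W y" using e(2) k \<open>k = c\<close> by force+
      then show "y \<in> U" using h_g[of "f y"] by (simp add: U_def)
    qed
    then show "\<exists>e>0. ball x e \<subseteq> U" using e(1) by blast
  qed
  then have "openin (top_of_set S) U"
    by (rule open_openin_trans[OF S(1)]) (auto simp: U_def)
  moreover have "x0 \<in> U" using x0 by (simp add: U_def c_def h_g)
  ultimately have "U = S" using S(2) connected_clopen by blast
  then show ?thesis using that(2)[of c] unfolding U_def by auto
qed (use that(1) in blast)

section \<open>The initial value problem on a half-line\<close>

lemma DERIV_h_shift: "((\<lambda>s. h (c - s)) has_real_derivative - h (c - s) * \<xi> (h (c - s))) (at s)"
proof -
  have "((-) c has_real_derivative - 1) (at s)" by (auto intro!: derivative_eq_intros)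
  from DERIV_chain2[OF DERIV_h this] show ?thesis by simp
qed

lemma ivp_solution_h: "ivp_solution \<xi> v (h (c - v)) (\<lambda>s. h (c - s))"
  unfolding ivp_solution_def
  using DERIV_h_shift h_pos by (auto intro!: continuous_intros intro: less_imp_le)

text \<open>The equation is imposed only for \<open>s > v\<close>, so the dichotomy is applied on
  the open half-line, with \<open>W\<close> the identity, and carried to the endpoint by continuity
  (\<open>extend\<close>).\<close>

lemma ivp_solution_cases:
  assumes "ivp_solution \<xi> v a p"
  obtains (zero) "\<And>s. v \<le> s \<Longrightarrow> p s = 0"
    | (shift) c where "\<And>s. v \<le> s \<Longrightarrow> p s = h (c - s)"
proof -
  have p: "continuous_on {v..} p" "\<And>s. v \<le> s \<Longrightarrow> 0 \<le> p s"
    "\<And>s. v < s \<Longrightarrow> (p has_real_derivative - p s * \<xi> (p s)) (at s)"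
    using assms unfolding ivp_solution_def by auto
  have extend: "p s = q s"
    if "continuous_on {v..} q" "\<And>s. s \<in> {v<..} \<Longrightarrow> p s = q s" "v \<le> s" for q s
  proof -
    have "p s - q s = 0"
    proof (rule continuous_constant_on_closure[of "{v<..}" "\<lambda>s. p s - q s"])
      show "continuous_on (closure {v<..}) (\<lambda>s. p s - q s)"
        using that(1) p(1) by (auto intro: continuous_intros)
    qed (use that in auto)
    then show ?thesis by simp
  qed
  show thesis
  proof (rule zero_flux_cases[of "{v<..}" p "\<lambda>_ t. t" "\<lambda>s. s"])
    show "(p has_derivative (\<lambda>t. - (p s * \<xi> (p s)) * t)) (at s)" if "s \<in> {v<..}" for s
      using p(3)[of s] that unfolding has_field_derivative_def
      by (auto elim!: has_derivative_eq_rhs simp: fun_eq_iff)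
    show "0 \<le> p s" if "s \<in> {v<..}" for s using p(2) that by simp
    show thesis if "\<And>s. s \<in> {v<..} \<Longrightarrow> p s = 0"
      using that extend[of "\<lambda>_. 0"] by (intro zero) auto
    show thesis if "\<And>s. s \<in> {v<..} \<Longrightarrow> p s = h (c - s)" for c
    proof (rule shift[of c])
      have "continuous_on {v..} (\<lambda>s. h (c - s))" by (intro continuous_intros)
      then show "p s = h (c - s)" if "v \<le> s" for s
        using \<open>\<And>s. s \<in> {v<..} \<Longrightarrow> p s = h (c - s)\<close> that by (rule extend)
    qed
  qed auto
qed

end

section \<open>Mass as a function of the shift\<close>

locale potential_coefficient = coefficient +
  fixes V :: "'a::euclidean_space \<Rightarrow> real"
  assumes P: "condition_P V"
begin

lemma C1_V: "C1 V"
  using P C2_imp_C1 unfolding condition_P_def by blast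

lemma nn_integral_V:
  fixes \<phi> :: "real \<Rightarrow> ennreal"
  assumes "\<phi> \<in> borel_measurable borel"
  shows "(\<integral>\<^sup>+ x. \<phi> (V x) \<partial>lborel) = (\<integral>\<^sup>+ s\<in>{v_star V<..}. \<phi> s * m_V V s \<partial>lebesgue)"
  using P assms unfolding condition_P_def by blast

lemma borel_measurable_h_V [measurable]: "(\<lambda>x. h (c - V x)) \<in> borel_measurable borel"
  by (intro borel_measurable_continuous_onI continuous_intros C1_imp_continuous_on C1_V)

text \<open>Comparing the arguments \<open>c - V x\<close> and \<open>c - v_star V\<close> in
  \<open>h_growth\<close> bounds the integrand by a multiple of
  \<open>exp (- \<kappa> * V x)\<close>, which is integrable by \<open>condition_P\<close>.\<close>

lemma integrable_h: "integrable lborel (\<lambda>x. h (c - V x))"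
proof (rule Bochner_Integration.integrable_bound)
  let ?C = "h (c - v_star V) * exp (\<kappa> * v_star V)"
  show "integrable lborel (\<lambda>x. ?C * exp (- \<kappa> * V x))"
    using P kappa_pos unfolding condition_P_def by (intro integrable_mult_right) blast
  have "h (c - V x) \<le> ?C * exp (- \<kappa> * V x)" for x
  proof -
    have "exp (\<kappa> * (V x - v_star V)) * h (c - V x) \<le> h (c - v_star V)"
      using h_growth(1)[of "c - V x" "c - v_star V"] v_star_le[OF P, of x] by simp
    then have "exp (- (\<kappa> * (V x - v_star V))) * (exp (\<kappa> * (V x - v_star V)) * h (c - V x))
        \<le> exp (- (\<kappa> * (V x - v_star V))) * h (c - v_star V)"
      by (intro mult_left_mono) auto
    also have "exp (- (\<kappa> * (V x - v_star V))) * (exp (\<kappa> * (V x - v_star V)) * h (c - V x))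
        = h (c - V x)"
      by (simp add: exp_minus)
    also have "exp (- (\<kappa> * (V x - v_star V))) = exp (\<kappa> * v_star V) * exp (- \<kappa> * V x)"
      by (simp add: algebra_simps flip: exp_add)
    finally show ?thesis by (simp add: mult_ac)
  qed
  then show "AE x in lborel. norm (h (c - V x)) \<le> norm (?C * exp (- \<kappa> * V x))"
    using h_pos by (intro AE_I2) (simp add: less_imp_le abs_mult)
qed simp

text \<open>A real-valued counterpart of \<open>mass\<close>, so that logarithms can be taken;
  \<open>mass_h\<close> identifies the two.\<close>

definition M :: "real \<Rightarrow> real" where
  "M c = (\<integral>x. h (c - V x) \<partial>lborel)"

text \<open>If the integral of a positive function vanished, the whole space would be a Lebesgue
  null set.\<close>

lemma M_pos: "0 < M c"
proof -
  have "M c \<noteq> 0"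
  proof
    assume "M c = 0"
    then have "AE x in lborel. h (c - V x) = 0"
      using integral_nonneg_eq_0_iff_AE[OF integrable_h[of c]] h_pos
      by (simp add: M_def less_imp_le)
    then have "AE x::'a in lborel. False"
      by eventually_elim (use h_pos in \<open>metis less_irrefl\<close>)
    then show False by (simp add: AE_iff_measurable[OF _ refl])
  qed
  moreover have "0 \<le> M c"
    unfolding M_def using h_pos by (intro integral_nonneg_AE AE_I2) (simp add: less_imp_le)
  ultimately show ?thesis by simp
qed

text \<open>The image-measure formula of \<open>condition_P\<close> turns the integral over levels
  into one over space.\<close>

lemma mass_h: "mass V (\<lambda>s. h (c - s)) = ennreal (M c)"
proof -
  have "(\<lambda>s. ennreal (h (c - s))) \<in> borel_measurable borel"
    by (intro measurable_compose[OF _ measurable_ennreal] borel_measurable_continuous_onI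
        continuous_intros)
  then have "mass V (\<lambda>s. h (c - s)) = (\<integral>\<^sup>+ x. ennreal (h (c - V x)) \<partial>lborel)"
    unfolding mass_def by (rule nn_integral_V[symmetric])
  also have "\<dots> = ennreal (M c)"
    unfolding M_def using h_pos
    by (intro nn_integral_eq_integral integrable_h AE_I2) (simp add: less_imp_le)
  finally show ?thesis .
qed

lemma mass_h_eq_1_iff: "mass V (\<lambda>s. h (c - s)) = 1 \<longleftrightarrow> M c = 1"
  using M_pos[of c] by (simp add: mass_h)

text \<open>The factors in \<open>h_growth\<close> do not depend on the level, so they pass through
  the integral and become additive under the logarithm.\<close>

lemma ln_M_bounds:
  assumes "a \<le> b"
  shows "\<kappa> * (b - a) \<le> ln (M b) - ln (M a) \<and> ln (M b) - ln (M a) \<le> K * (b - a)"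
proof
  have "exp (\<kappa> * (b - a)) * M a = (\<integral>x. exp (\<kappa> * (b - a)) * h (a - V x) \<partial>lborel)"
    unfolding M_def by (rule integral_mult_right_zero[symmetric])
  also have "\<dots> \<le> M b"
    unfolding M_def
  proof (intro integral_mono integrable_mult_right integrable_h)
    fix x
    show "exp (\<kappa> * (b - a)) * h (a - V x) \<le> h (b - V x)"
      using h_growth(1)[of "a - V x" "b - V x"] assms by simp
  qed
  finally have "ln (exp (\<kappa> * (b - a)) * M a) \<le> ln (M b)"
    using M_pos by (subst ln_le_cancel_iff) auto
  then show "\<kappa> * (b - a) \<le> ln (M b) - ln (M a)"
    using M_pos[of a] by (simp add: ln_mult)
  have "M b \<le> (\<integral>x. exp (K * (b - a)) * h (a - V x) \<partial>lborel)"
    unfolding M_def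
  proof (intro integral_mono integrable_mult_right integrable_h)
    fix x
    show "h (b - V x) \<le> exp (K * (b - a)) * h (a - V x)"
      using h_growth(2)[of "a - V x" "b - V x"] assms by simp
  qed
  also have "\<dots> = exp (K * (b - a)) * M a"
    unfolding M_def by (rule integral_mult_right_zero)
  finally have "ln (M b) \<le> ln (exp (K * (b - a)) * M a)"
    using M_pos by (subst ln_le_cancel_iff) auto
  then show "ln (M b) - ln (M a) \<le> K * (b - a)"
    using M_pos[of a] by (simp add: ln_mult)
qed

lemma ex1_mass_1: "\<exists>!c. mass V (\<lambda>s. h (c - s)) = 1"
proof -
  have "\<exists>!c. ln (M c) = 0"
    using kappa_pos ln_M_bounds by (rule bilipschitz_unique_root)
  then show ?thesis using M_pos by (simp add: mass_h_eq_1_iff)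
qed

text \<open>Unique existence gives the \<open>THE\<close> in \<open>mu\<close> its meaning.\<close>

lemma mass_1_iff: "mass V (\<lambda>s. h (c - s)) = 1 \<longleftrightarrow> c = mu V \<xi>"
  using theI'[OF ex1_mass_1] ex1_mass_1 unfolding mu_def by blast

section \<open>Stationary densities\<close>

text \<open>In the dichotomy on the whole space, total mass 1 excludes the zero function and leaves
  only one shift.\<close>

lemma zero_flux_stationary_density_iff:
  "zero_flux_stationary_density V \<xi> \<pi> \<longleftrightarrow> \<pi> = (\<lambda>x. h (mu V \<xi> - V x))"
proof
  assume \<pi>: "zero_flux_stationary_density V \<xi> \<pi>"
  then have int: "has_bochner_integral lborel \<pi> 1" and C1: "C1 \<pi>"
    unfolding zero_flux_stationary_density_def by auto
  show "\<pi> = (\<lambda>x. h (mu V \<xi> - V x))"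
  proof (rule zero_flux_cases[of UNIV \<pi> "\<lambda>x y. y \<bullet> gradient V x" V])
    fix x
    have "gradient \<pi> x = - (\<pi> x * \<xi> (\<pi> x)) *\<^sub>R gradient V x"
      using \<pi> unfolding zero_flux_stationary_density_def by (simp add: eq_neg_iff_add_eq_0)
    then show "(\<pi> has_derivative (\<lambda>y. - (\<pi> x * \<xi> (\<pi> x)) * (y \<bullet> gradient V x))) (at x)"
      using has_derivative_gradient[OF C1_imp_differentiable[OF C1], of x] by simp
    show "(V has_derivative (\<lambda>y. y \<bullet> gradient V x)) (at x)"
      using has_derivative_gradient[OF C1_imp_differentiable[OF C1_V]] .
    show "0 \<le> \<pi> x" using \<pi> unfolding zero_flux_stationary_density_def by blast
  next
    assume "\<And>x. x \<in> UNIV \<Longrightarrow> \<pi> x = 0"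
    then have "\<pi> = (\<lambda>x. 0)" by auto
    then have False
      using int has_bochner_integral_integral_eq by fastforce
    then show ?thesis ..
  next
    fix c assume "\<And>x. x \<in> UNIV \<Longrightarrow> \<pi> x = h (c - V x)"
    then have eq: "\<pi> = (\<lambda>x. h (c - V x))" by auto
    then have "M c = 1" using int has_bochner_integral_integral_eq unfolding M_def by blast
    then show ?thesis using eq mass_1_iff mass_h_eq_1_iff by simp
  qed auto
next
  assume eq: "\<pi> = (\<lambda>x. h (mu V \<xi> - V x))"
  obtain V' :: "'a \<Rightarrow> 'a \<Rightarrow>\<^sub>L real" where V': "\<And>x. (V has_derivative V' x) (at x)" "continuous_on UNIV V'"
    using C1_V unfolding C1_def by blast
  have D: "(\<pi> has_derivative (\<lambda>y. W' y * (- \<pi> x * \<xi> (\<pi> x)))) (at x)"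
    if "(V has_derivative W') (at x)" for x W'
    unfolding eq by (rule DERIV_compose_FDERIV[OF DERIV_h_shift that])
  have "C1 \<pi>"
    unfolding C1_def
  proof (intro exI conjI allI)
    show "(\<pi> has_derivative ((- \<pi> x * \<xi> (\<pi> x)) *\<^sub>R V' x)) (at x)" for x
      using D[OF V'(1)[of x]]
      by (rule has_derivative_eq_rhs) (simp add: blinfun.bilinear_simps fun_eq_iff)
    \<comment> \<open>\<open>C1\<close> demands a derivative continuous as a bounded linear map; the
      scalar factor is continuous because \<open>\<xi>\<close> is evaluated only at the positive
      values of \<open>h\<close>.\<close>
    show "continuous_on UNIV (\<lambda>x. (- \<pi> x * \<xi> (\<pi> x)) *\<^sub>R V' x)"
      unfolding eq
      by (intro continuous_intros continuous_on_xi_h V' C1_imp_continuous_on C1_V)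
  qed
  moreover have "gradient \<pi> x + (\<pi> x * \<xi> (\<pi> x)) *\<^sub>R gradient V x = 0" for x
  proof -
    have "GDERIV \<pi> x :> - (\<pi> x * \<xi> (\<pi> x)) *\<^sub>R gradient V x"
      using D[OF has_derivative_gradient[OF C1_imp_differentiable[OF C1_V]], of x]
      by (simp add: gderiv_def mult.commute)
    from gradient_eq[OF this] show ?thesis by simp
  qed
  moreover have "has_bochner_integral lborel \<pi> 1"
    using integrable_h[of "mu V \<xi>"] mass_1_iff[of "mu V \<xi>"] mass_h_eq_1_iff
    by (simp add: eq has_bochner_integral_iff M_def)
  ultimately show "zero_flux_stationary_density V \<xi> \<pi>"
    unfolding zero_flux_stationary_density_def using h_pos by (simp add: eq less_imp_le)
qed

text \<open>For a shifted \<open>h\<close>, the initial value determines the shift by injectivity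
  and the normalisation determines it by \<open>mass_1_iff\<close>; both conditions select
  \<open>mu\<close>. The zero solution fails both.\<close>

lemma ivp_solution_mass_1_iff:
  assumes "ivp_solution \<xi> (v_star V) a p"
  shows "mass V p = 1 \<longleftrightarrow> a = q_fun V \<xi> (v_star V)"
    and "mass V p = 1 \<Longrightarrow> v_star V \<le> s \<Longrightarrow> p s = q_fun V \<xi> s"
proof -
  have a: "p (v_star V) = a" using assms unfolding ivp_solution_def by blast
  have "(mass V p = 1 \<longleftrightarrow> a = q_fun V \<xi> (v_star V)) \<and>
      (mass V p = 1 \<longrightarrow> (\<forall>s\<ge>v_star V. p s = q_fun V \<xi> s))"
    using assms
  proof (cases rule: ivp_solution_cases)
    case zero
    have "mass V p = mass V (\<lambda>_. 0)" using zero by (intro mass_cong) simp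
    then have "mass V p = 0" by (simp add: mass_def)
    moreover have "a \<noteq> q_fun V \<xi> (v_star V)"
      using zero[of "v_star V"] a h_pos[of "mu V \<xi> - v_star V"] by (simp add: q_fun_def)
    ultimately show ?thesis by simp
  next
    case (shift c)
    have "mass V p = mass V (\<lambda>s. h (c - s))" using shift by (intro mass_cong) simp
    then have "mass V p = 1 \<longleftrightarrow> c = mu V \<xi>" by (simp add: mass_1_iff)
    moreover have "a = q_fun V \<xi> (v_star V) \<longleftrightarrow> c = mu V \<xi>"
      using shift[of "v_star V"] a h_inj[of "c - v_star V" "mu V \<xi> - v_star V"]
      by (auto simp: q_fun_def)
    ultimately show ?thesis using shift by (simp add: q_fun_def)
  qed
  then show "mass V p = 1 \<longleftrightarrow> a = q_fun V \<xi> (v_star V)"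
    and "mass V p = 1 \<Longrightarrow> v_star V \<le> s \<Longrightarrow> p s = q_fun V \<xi> s" by auto
qed

end

text \<open>The last two conjuncts range over arbitrary solutions of the initial value problem:
  normalisation is a condition on the initial value, and the normalised solutions composed with
  \<open>V\<close> are the stationary densities.\<close>

theorem proposition3p4:
  fixes V :: "'a::euclidean_space \<Rightarrow> real" and \<xi> :: "real \<Rightarrow> real"
  assumes "condition_P V" and "condition_C \<xi>"
  shows "(\<exists>!\<pi>. zero_flux_stationary_density V \<xi> \<pi>) \<and>
    (\<exists>!\<mu>. mass V (\<lambda>s. g_inv \<xi> (\<mu> - s)) = 1) \<and>
    zero_flux_stationary_density V \<xi> (\<lambda>x. g_inv \<xi> (mu V \<xi> - V x)) \<and>
    ivp_solution \<xi> (v_star V) (q_fun V \<xi> (v_star V)) (q_fun V \<xi>) \<and>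
    mass V (q_fun V \<xi>) = 1 \<and>
    (\<forall>a p. ivp_solution \<xi> (v_star V) a p \<longrightarrow>
       (mass V p = 1 \<longleftrightarrow> a = q_fun V \<xi> (v_star V))) \<and>
    (\<forall>\<pi>. zero_flux_stationary_density V \<xi> \<pi> \<longleftrightarrow>
       (\<exists>a p. ivp_solution \<xi> (v_star V) a p \<and> mass V p = 1 \<and> (\<forall>x. \<pi> x = p (V x))))"
proof -
  obtain \<kappa> K L where *: "0 < \<kappa>" "\<forall>r\<ge>0. \<kappa> \<le> \<xi> r \<and> \<xi> r \<le> K"
    and L: "\<forall>r\<ge>0. \<forall>u\<ge>0. \<bar>\<xi> r - \<xi> u\<bar> \<le> L * \<bar>r - u\<bar>"
    using assms(2) unfolding condition_C_def by blast
  \<comment> \<open>\<open>condition_C\<close> leaves the sign of \<open>L\<close> open, whereas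
    \<open>lipschitz_on\<close> includes nonnegativity.\<close>
  have "0 \<le> L" using L[rule_format, of 0 1] by simp
  then have "L-lipschitz_on {0..} \<xi>"
    using L by (auto intro!: lipschitz_onI simp: dist_real_def)
  then interpret potential_coefficient \<xi> \<kappa> K V
    using * assms(1) lipschitz_on_continuous_on by unfold_locales blast+
  have q: "ivp_solution \<xi> (v_star V) (q_fun V \<xi> (v_star V)) (q_fun V \<xi>)"
    unfolding q_fun_def using ivp_solution_h .
  have m: "mass V (q_fun V \<xi>) = 1"
    using mass_1_iff[of "mu V \<xi>"] by (simp add: q_fun_def[abs_def])
  have "zero_flux_stationary_density V \<xi> \<pi> \<longleftrightarrow>
      (\<exists>a p. ivp_solution \<xi> (v_star V) a p \<and> mass V p = 1 \<and> (\<forall>x. \<pi> x = p (V x)))" for \<pi>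
  proof
    assume "zero_flux_stationary_density V \<xi> \<pi>"
    then have "\<forall>x. \<pi> x = q_fun V \<xi> (V x)"
      by (simp add: zero_flux_stationary_density_iff q_fun_def)
    then show "\<exists>a p. ivp_solution \<xi> (v_star V) a p \<and> mass V p = 1 \<and> (\<forall>x. \<pi> x = p (V x))"
      using q m by blast
  next
    assume "\<exists>a p. ivp_solution \<xi> (v_star V) a p \<and> mass V p = 1 \<and> (\<forall>x. \<pi> x = p (V x))"
    \<comment> \<open>Solutions are determined only from \<open>v_star V\<close> upwards, which
      covers every value of \<open>V\<close>.\<close>
    then have "\<pi> x = q_fun V \<xi> (V x)" for x
      using ivp_solution_mass_1_iff(2) v_star_le[OF assms(1)] by metis
    then show "zero_flux_stationary_density V \<xi> \<pi>"
      by (auto simp: zero_flux_stationary_density_iff q_fun_def)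
  qed
  then show ?thesis
    using q m ex1_mass_1 ivp_solution_mass_1_iff(1)
    unfolding zero_flux_stationary_density_iff by blast
qed

end
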